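(* Let $p$ be an odd prime, and let $E$ and $H$ be the groups given in the variety $\mathcal N_{2,p}$ by the presentations $$E=\langle \{x_i\}_{i\in\mathbb N},\, z \;:\; [x_i,x_k]=z \ \ (0\le i<k)\rangle ,$$ $$H=\langle \{x_i\}_{i\in\mathbb N},\, \{z_k\}_{k\in\mathbb N^+} \;:\; [x_i,x_k]=z_k \ \ (0\le i<k)\rangle .$$ Then neither $E$ nor $H$ has an abelian subgroup of finite index.
   Context: $\mathbb N=\{0,1,2,\dots\}$, $\mathbb N^+=\{1,2,\dots\}$ and $[x,y]=x^{-1}y^{-1}xy$. $\mathcal N_{2,p}$ is the variety of groups satisfying the laws $[[x,y],z]=1$ and $x^p=1$. A presentation in the variety $\mathcal N_{2,p}$ denotes the quotient of the free group of $\mathcal N_{2,p}$ on the listed generators by the normal subgroup generated by the listed relations. *)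

theory Defs
  imports "HOL-Algebra.Generated_Groups" "HOL-Computational_Algebra.Primes"
begin

section \<open>Free groups\<close>

text \<open>
  A word over S is a list of letters (a, e) with a in S; (a, True) stands for the generator a
  and (a, False) for its formal inverse.
\<close>

inductive_set free_rel :: "'a set \<Rightarrow> (('a \<times> bool) list \<times> ('a \<times> bool) list) set"
  for S :: "'a set" where
  refl: "w \<in> lists (S \<times> UNIV) \<Longrightarrow> (w, w) \<in> free_rel S"
| sym: "(v, w) \<in> free_rel S \<Longrightarrow> (w, v) \<in> free_rel S"
| trans: "(u, v) \<in> free_rel S \<Longrightarrow> (v, w) \<in> free_rel S \<Longrightarrow> (u, w) \<in> free_rel S"
| cancel: "u \<in> lists (S \<times> UNIV) \<Longrightarrow> v \<in> lists (S \<times> UNIV) \<Longrightarrow> a \<in> S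
    \<Longrightarrow> (u @ [(a, e), (a, \<not> e)] @ v, u @ v) \<in> free_rel S"

definition free_group :: "'a set \<Rightarrow> ('a \<times> bool) list set monoid" where
  "free_group S =
    \<lparr>carrier = lists (S \<times> UNIV) // free_rel S,
     monoid.mult = (\<lambda>A B. \<Union>u\<in>A. \<Union>v\<in>B. free_rel S `` {u @ v}),
     monoid.one = free_rel S `` {[]}\<rparr>"

definition free_gen :: "'a set \<Rightarrow> 'a \<Rightarrow> ('a \<times> bool) list set" where
  "free_gen S a = free_rel S `` {[(a, True)]}"

section \<open>Presentations in the variety of groups of class at most 2 and exponent dividing p\<close>

definition commutator :: "('a, 'b) monoid_scheme \<Rightarrow> 'a \<Rightarrow> 'a \<Rightarrow> 'a" where
  "commutator G x y = inv\<^bsub>G\<^esub> x \<otimes>\<^bsub>G\<^esub> inv\<^bsub>G\<^esub> y \<otimes>\<^bsub>G\<^esub> x \<otimes>\<^bsub>G\<^esub> y"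

definition normal_closure :: "('a, 'b) monoid_scheme \<Rightarrow> 'a set \<Rightarrow> 'a set" where
  "normal_closure G R = \<Inter>{N. N \<lhd> G \<and> R \<subseteq> N}"

text \<open>
  The verbal subgroup of the two laws [[x,y],z] = 1 and x^p = 1. Factoring it out of a free
  group gives the relatively free group.
\<close>

definition n2p_verbal :: "nat \<Rightarrow> ('a, 'b) monoid_scheme \<Rightarrow> 'a set" where
  "n2p_verbal p G = generate G
    ({commutator G (commutator G x y) z | x y z.
        x \<in> carrier G \<and> y \<in> carrier G \<and> z \<in> carrier G}
     \<union> {x [^]\<^bsub>G\<^esub> p | x. x \<in> carrier G})"

definition n2p_free :: "nat \<Rightarrow> 'a set \<Rightarrow> ('a \<times> bool) list set set monoid" where
  "n2p_free p S = free_group S Mod n2p_verbal p (free_group S)"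

definition n2p_gen :: "nat \<Rightarrow> 'a set \<Rightarrow> 'a \<Rightarrow> ('a \<times> bool) list set set" where
  "n2p_gen p S a = n2p_verbal p (free_group S) #>\<^bsub>free_group S\<^esub> free_gen S a"

text \<open>A pair (u, v) in R is the relation u = v between elements of the relatively free group on S.\<close>

definition n2p_presented ::
  "nat \<Rightarrow> 'a set \<Rightarrow> (('a \<times> bool) list set set \<times> ('a \<times> bool) list set set) set
    \<Rightarrow> ('a \<times> bool) list set set set monoid" where
  "n2p_presented p S R =
    n2p_free p S Mod normal_closure (n2p_free p S)
      {u \<otimes>\<^bsub>n2p_free p S\<^esub> inv\<^bsub>n2p_free p S\<^esub> v | u v. (u, v) \<in> R}"

section \<open>The groups E and H\<close>

datatype E_gen = XE nat | ZE

definition group_E :: "nat \<Rightarrow> (E_gen \<times> bool) list set set set monoid" where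
  "group_E p =
    (let S = range XE \<union> {ZE}; g = n2p_gen p S
     in n2p_presented p S
          {(commutator (n2p_free p S) (g (XE i)) (g (XE k)), g ZE) | i k. i < k})"

datatype H_gen = XH nat | ZH nat

text \<open>The generators z_k are indexed by k \<ge> 1, so ZH 0 is not among the generators.\<close>

definition group_H :: "nat \<Rightarrow> (H_gen \<times> bool) list set set set monoid" where
  "group_H p =
    (let S = range XH \<union> ZH ` {1..}; g = n2p_gen p S
     in n2p_presented p S
          {(commutator (n2p_free p S) (g (XH i)) (g (XH k)), g (ZH k)) | i k. i < k})"

section \<open>Abelian subgroups of finite index\<close>

definition has_abelian_finite_index_subgroup :: "('a, 'b) monoid_scheme \<Rightarrow> bool" where
  "has_abelian_finite_index_subgroup G \<longleftrightarrow>
    (\<exists>A. subgroup A G \<and> comm_group (G\<lparr>carrier := A\<rparr>) \<and> finite (rcosets\<^bsub>G\<^esub> A))"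

end

theory Submission
  imports Defs "HOL.Modules" "HOL-Library.Function_Algebras" "HOL-Library.Infinite_Set"
begin

text \<open>
  Let \<open>A\<close> be an abelian subgroup of finite index. By the pigeonhole principle there are
  \<open>i < j < k\<close> such that \<open>x\<^sub>i\<close>, \<open>x\<^sub>j\<close>, \<open>x\<^sub>k\<close> lie in the same right coset
  of \<open>A\<close>, so that \<open>x\<^sub>i x\<^sub>j\<^sup>-\<^sup>1\<close> and \<open>x\<^sub>i x\<^sub>k\<^sup>-\<^sup>1\<close> are in
  \<open>A\<close> and commute. In both groups, by bilinearity, their commutator is \<open>[x\<^sub>i, x\<^sub>j]\<close>.
  This is nontrivial because \<open>E\<close> and \<open>H\<close> both map to a Heisenberg group modulo \<open>p\<close>
  of infinite rank in which the images of the \<open>x\<^sub>i\<close> satisfy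
  \<open>[x\<^sub>i, x\<^sub>k] = z \<noteq> 1\<close> for all \<open>i < k\<close> (all \<open>z\<^sub>k\<close> are sent to \<open>z\<close>).
\<close>

section \<open>The free group and its universal property\<close>

lemma free_rel_in_lists:
  "(u, v) \<in> free_rel S \<Longrightarrow> u \<in> lists (S \<times> UNIV) \<and> v \<in> lists (S \<times> UNIV)"
  by (induction rule: free_rel.induct) auto

lemma equiv_free_rel: "equiv (lists (S \<times> UNIV)) (free_rel S)"
proof (rule equivI)
  show "free_rel S \<subseteq> lists (S \<times> UNIV) \<times> lists (S \<times> UNIV)"
    by (rule subrelI) (simp add: free_rel_in_lists del: in_lists_conv_set)
  show "refl_on (lists (S \<times> UNIV)) (free_rel S)"
    by (rule refl_onI) (rule free_rel.refl)
  show "sym (free_rel S)"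
    by (rule symI) (rule free_rel.sym)
  show "trans (free_rel S)"
    by (rule transI) (rule free_rel.trans)
qed

lemma free_rel_append_right:
  "(u, v) \<in> free_rel S \<Longrightarrow> w \<in> lists (S \<times> UNIV) \<Longrightarrow> (u @ w, v @ w) \<in> free_rel S"
proof (induction rule: free_rel.induct)
  case (cancel u v a e)
  then show ?case using free_rel.cancel[of u S "v @ w" a e] by simp
qed (metis free_rel.intros(1-3) append_in_lists_conv)+

lemma free_rel_append_left:
  "(u, v) \<in> free_rel S \<Longrightarrow> w \<in> lists (S \<times> UNIV) \<Longrightarrow> (w @ u, w @ v) \<in> free_rel S"
proof (induction rule: free_rel.induct)
  case (cancel u v a e)
  then show ?case using free_rel.cancel[of "w @ u" S v a e] by simp
qed (metis free_rel.intros(1-3) append_in_lists_conv)+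

text \<open>The product is defined as a union over all representatives; it is a single class because
  appending a word on either side respects \<open>free_rel\<close>.\<close>

lemma free_group_mult:
  assumes "u \<in> lists (S \<times> UNIV)" "v \<in> lists (S \<times> UNIV)"
  shows "free_rel S `` {u} \<otimes>\<^bsub>free_group S\<^esub> free_rel S `` {v} = free_rel S `` {u @ v}"
proof -
  have "congruent2 (free_rel S) (free_rel S) (\<lambda>u v. free_rel S `` {u @ v})"
  proof (rule congruent2I[OF equiv_free_rel equiv_free_rel])
    fix y z w :: "('a \<times> bool) list"
    assume w: "w \<in> lists (S \<times> UNIV)" and yz: "(y, z) \<in> free_rel S"
    show "free_rel S `` {y @ w} = free_rel S `` {z @ w}"
      by (rule equiv_class_eq[OF equiv_free_rel free_rel_append_right[OF yz w]])
    show "free_rel S `` {w @ y} = free_rel S `` {w @ z}"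
      by (rule equiv_class_eq[OF equiv_free_rel free_rel_append_left[OF yz w]])
  qed
  from UN_equiv_class2[OF equiv_free_rel equiv_free_rel this assms]
  show ?thesis by (simp add: free_group_def)
qed

lemma free_group_carrier: "carrier (free_group S) = (\<lambda>w. free_rel S `` {w}) ` lists (S \<times> UNIV)"
  by (auto simp: free_group_def quotient_def)

lemma free_rel_inverse:
  "w \<in> lists (S \<times> UNIV) \<Longrightarrow> (rev (map (\<lambda>(a, e). (a, \<not> e)) w) @ w, []) \<in> free_rel S"
proof (induction w)
  case Nil
  then show ?case by (auto intro: free_rel.refl)
next
  case (Cons x w)
  obtain a e where x: "x = (a, e)" by force
  let ?r = "rev (map (\<lambda>(a, e). (a, \<not> e)) w)"
  have "?r \<in> lists (S \<times> UNIV)" "w \<in> lists (S \<times> UNIV)" "a \<in> S"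
    using Cons.prems x by (auto simp: in_lists_conv_set)
  \<comment> \<open>Reversal puts the first letter of the word next to its formal inverse, so
    \<open>cancel\<close> removes this pair from the middle and leaves the shorter word of the
    induction hypothesis.\<close>
  then have "(?r @ [(a, \<not> e), (a, \<not> \<not> e)] @ w, ?r @ w) \<in> free_rel S"
    by (rule free_rel.cancel)
  with Cons show ?case by (auto simp: x intro: free_rel.trans)
qed

lemma group_free_group: "group (free_group S)"
proof (rule groupI)
  fix x y assume "x \<in> carrier (free_group S)" "y \<in> carrier (free_group S)"
  then show "x \<otimes>\<^bsub>free_group S\<^esub> y \<in> carrier (free_group S)"
    unfolding free_group_carrier
    by (elim imageE) (simp add: free_group_mult)
next
  show "\<one>\<^bsub>free_group S\<^esub> \<in> carrier (free_group S)"
    by (auto simp: free_group_def quotient_def)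
next
  fix x y z assume "x \<in> carrier (free_group S)" "y \<in> carrier (free_group S)" "z \<in> carrier (free_group S)"
  then show "x \<otimes>\<^bsub>free_group S\<^esub> y \<otimes>\<^bsub>free_group S\<^esub> z = x \<otimes>\<^bsub>free_group S\<^esub> (y \<otimes>\<^bsub>free_group S\<^esub> z)"
    unfolding free_group_carrier
    by (elim imageE) (simp add: free_group_mult)
next
  have one: "\<one>\<^bsub>free_group S\<^esub> = free_rel S `` {[]}" by (simp add: free_group_def)
  fix x assume "x \<in> carrier (free_group S)"
  then obtain w where w: "w \<in> lists (S \<times> UNIV)" "x = free_rel S `` {w}"
    by (auto simp: free_group_carrier)
  then show "\<one>\<^bsub>free_group S\<^esub> \<otimes>\<^bsub>free_group S\<^esub> x = x"
    by (simp add: one free_group_mult)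
  let ?r = "rev (map (\<lambda>(a, e). (a, \<not> e)) w)"
  have r: "?r \<in> lists (S \<times> UNIV)" using w by (auto simp: in_lists_conv_set)
  have "free_rel S `` {?r} \<otimes>\<^bsub>free_group S\<^esub> x = \<one>\<^bsub>free_group S\<^esub>"
    using equiv_class_eq[OF equiv_free_rel free_rel_inverse[OF w(1)]] r w
    by (simp add: one free_group_mult)
  moreover have "free_rel S `` {?r} \<in> carrier (free_group S)"
    unfolding free_group_carrier using r by (rule imageI)
  ultimately show "\<exists>y\<in>carrier (free_group S). y \<otimes>\<^bsub>free_group S\<^esub> x = \<one>\<^bsub>free_group S\<^esub>"
    by (rule bexI)
qed

section \<open>Evaluation of words and extension of maps from the generators\<close>

definition word_eval :: "('b, 'c) monoid_scheme \<Rightarrow> ('a \<Rightarrow> 'b) \<Rightarrow> ('a \<times> bool) list \<Rightarrow> 'b" where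
  "word_eval K f w =
    foldr (\<lambda>(a, e) x. (if e then f a else inv\<^bsub>K\<^esub> f a) \<otimes>\<^bsub>K\<^esub> x) w \<one>\<^bsub>K\<^esub>"

lemma word_eval_Nil [simp]: "word_eval K f [] = \<one>\<^bsub>K\<^esub>"
  and word_eval_Cons [simp]:
    "word_eval K f ((a, e) # w) = (if e then f a else inv\<^bsub>K\<^esub> f a) \<otimes>\<^bsub>K\<^esub> word_eval K f w"
  by (simp_all add: word_eval_def)

context group
begin

lemma word_eval_closed:
  assumes "f \<in> S \<rightarrow> carrier G" "w \<in> lists (S \<times> UNIV)"
  shows "word_eval G f w \<in> carrier G"
  using assms(2) by (induction w) (use assms(1) in \<open>auto simp: Pi_iff\<close>)

lemma word_eval_append:
  assumes f: "f \<in> S \<rightarrow> carrier G" and "u \<in> lists (S \<times> UNIV)" and v: "v \<in> lists (S \<times> UNIV)"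
  shows "word_eval G f (u @ v) = word_eval G f u \<otimes> word_eval G f v"
  using assms(2)
proof (induction u)
  case (Cons x u)
  then show ?case
    using f word_eval_closed[OF f v] word_eval_closed[OF f, of u]
    by (cases x) (auto simp: m_assoc Pi_iff)
qed (simp add: word_eval_closed[OF f v])

lemma word_eval_free_rel:
  assumes "(u, v) \<in> free_rel S" and f: "f \<in> S \<rightarrow> carrier G"
  shows "word_eval G f u = word_eval G f v"
  using assms(1)
proof (induction rule: free_rel.induct)
  case (cancel u v a e)
  then have "word_eval G f ([(a, e), (a, \<not> e)] @ v) = word_eval G f v"
    using f word_eval_closed[OF f cancel(2)]
    by (auto simp: Pi_iff m_assoc[symmetric])
  then show ?case
    using word_eval_append[OF f cancel(1), of "[(a, e), (a, \<not> e)] @ v"]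
      word_eval_append[OF f cancel(1,2)] cancel by simp
qed auto

lemma free_group_universal:
  assumes f: "f \<in> S \<rightarrow> carrier G"
  obtains h where "h \<in> hom (free_group S) G" "\<And>a. a \<in> S \<Longrightarrow> h (free_gen S a) = f a"
proof
  \<comment> \<open>Evaluation is constant on each class, so its image is a singleton and
    \<open>the_elem\<close> reads off the value without a choice of representative.\<close>
  define h where "h A = the_elem (word_eval G f ` A)" for A
  have h: "h (free_rel S `` {w}) = word_eval G f w" if "w \<in> lists (S \<times> UNIV)" for w
  proof -
    have "word_eval G f v = word_eval G f w" if "v \<in> free_rel S `` {w}" for v
      using word_eval_free_rel[OF _ f, of w v] that by simp
    moreover have "w \<in> free_rel S `` {w}"
      using free_rel.refl[OF that] by simp
    ultimately have "word_eval G f ` (free_rel S `` {w}) = {word_eval G f w}"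
      by blast
    then show ?thesis by (simp add: h_def)
  qed
  show "h \<in> hom (free_group S) G"
    by (rule homI; unfold free_group_carrier; elim imageE)
      (simp_all add: h free_group_mult word_eval_closed[OF f] word_eval_append[OF f])
  show "h (free_gen S a) = f a" if "a \<in> S" for a
    using that f by (auto simp: free_gen_def h Pi_iff)
qed

end

lemma free_gen_closed: "a \<in> S \<Longrightarrow> free_gen S a \<in> carrier (free_group S)"
  by (auto simp: free_gen_def free_group_carrier)

section \<open>Presentations in the variety\<close>

lemma (in group) commutator_closed [simp]:
  "x \<in> carrier G \<Longrightarrow> y \<in> carrier G \<Longrightarrow> commutator G x y \<in> carrier G"
  by (simp add: commutator_def)

lemma (in group_hom) hom_commutator:
  "x \<in> carrier G \<Longrightarrow> y \<in> carrier G \<Longrightarrow> h (commutator G x y) = commutator H (h x) (h y)"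
  by (simp add: commutator_def)

text \<open>Every endomorphism maps commutators \<open>[[x,y],z]\<close> and powers
  \<open>x^p\<close> to elements of the same shape. Conjugation by \<open>g\<close> is an
  endomorphism, so the generating set is stable under it.\<close>

lemma (in group) normal_n2p_verbal: "n2p_verbal p G \<lhd> G"
  unfolding n2p_verbal_def
proof (rule normal_generateI, goal_cases)
  case 1
  then show ?case by auto
next
  case (2 h g)
  define c where "c x = g \<otimes> x \<otimes> inv g" for x
  have "c \<in> hom G G"
  proof (rule homI)
    fix x y assume xy: "x \<in> carrier G" "y \<in> carrier G"
    have "inv g \<otimes> (g \<otimes> (y \<otimes> inv g)) = y \<otimes> inv g"
      using xy 2 by (simp add: m_assoc[symmetric])
    then show "c (x \<otimes> y) = c x \<otimes> c y"
      using xy 2 by (simp add: c_def m_assoc)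
  qed (use 2 in \<open>simp add: c_def\<close>)
  then interpret c: group_hom G G c
    by unfold_locales
  from 2(1) show ?case
  proof
    assume "h \<in> {commutator G (commutator G x y) z | x y z.
      x \<in> carrier G \<and> y \<in> carrier G \<and> z \<in> carrier G}"
    then obtain x y z where "h = commutator G (commutator G x y) z"
      and "x \<in> carrier G" "y \<in> carrier G" "z \<in> carrier G" by blast
    then have "c h = commutator G (commutator G (c x) (c y)) (c z)"
      and "c x \<in> carrier G" "c y \<in> carrier G" "c z \<in> carrier G"
      by (simp_all add: c.hom_commutator)
    then show ?thesis unfolding c_def[symmetric] by blast
  next
    assume "h \<in> {x [^] p | x. x \<in> carrier G}"
    then obtain x where "h = x [^] p" "x \<in> carrier G" by blast
    then have "c h = c x [^] p" "c x \<in> carrier G"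
      by (simp_all add: c.hom_nat_pow)
    then show ?thesis unfolding c_def[symmetric] by blast
  qed
qed

lemma (in group) normal_normal_closure:
  assumes "R \<subseteq> carrier G"
  shows "normal_closure G R \<lhd> G"
  unfolding normal_closure_def
proof (rule normal_invI)
  show "subgroup (\<Inter>{N. N \<lhd> G \<and> R \<subseteq> N}) G"
  proof (rule subgroups_Inter)
    \<comment> \<open>The whole carrier belongs to the family; an empty family would have the whole
      type as its intersection.\<close>
    show "{N. N \<lhd> G \<and> R \<subseteq> N} \<noteq> {}"
      using assms normal_self by blast
  qed (simp add: normal_imp_subgroup)
next
  fix x h assume "x \<in> carrier G" "h \<in> \<Inter>{N. N \<lhd> G \<and> R \<subseteq> N}"
  then show "x \<otimes> h \<otimes> inv x \<in> \<Inter>{N. N \<lhd> G \<and> R \<subseteq> N}"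
    by (simp add: normal_invE(2))
qed

section \<open>Homomorphisms from the relatively free group into groups of the variety\<close>

definition satisfies_n2p_laws :: "nat \<Rightarrow> ('a, 'b) monoid_scheme \<Rightarrow> bool" where
  "satisfies_n2p_laws p G \<longleftrightarrow>
    (\<forall>x\<in>carrier G. \<forall>y\<in>carrier G. \<forall>z\<in>carrier G. commutator G (commutator G x y) z = \<one>\<^bsub>G\<^esub>) \<and>
    (\<forall>x\<in>carrier G. x [^]\<^bsub>G\<^esub> p = \<one>\<^bsub>G\<^esub>)"

lemma (in group_hom) n2p_verbal_subset_kernel:
  assumes "satisfies_n2p_laws p H"
  shows "n2p_verbal p G \<subseteq> kernel G H h"
  unfolding n2p_verbal_def
  using assms
  by (intro G.generate_subgroup_incl subgroup_kernel)
    (auto simp: kernel_def satisfies_n2p_laws_def hom_commutator hom_nat_pow)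

lemma group_n2p_free: "group (n2p_free p S)"
  unfolding n2p_free_def
  by (rule normal.factorgroup_is_group[OF group.normal_n2p_verbal[OF group_free_group]])

lemma n2p_gen_closed: "a \<in> S \<Longrightarrow> n2p_gen p S a \<in> carrier (n2p_free p S)"
  by (auto simp: n2p_gen_def n2p_free_def carrier_FactGroup free_gen_closed)

lemma (in group) n2p_free_universal:
  assumes laws: "satisfies_n2p_laws p G" and f: "f \<in> S \<rightarrow> carrier G"
  obtains h where "h \<in> hom (n2p_free p S) G" "\<And>a. a \<in> S \<Longrightarrow> h (n2p_gen p S a) = f a"
proof -
  interpret F: group "free_group S" by (rule group_free_group)
  obtain h where h: "h \<in> hom (free_group S) G" "\<And>a. a \<in> S \<Longrightarrow> h (free_gen S a) = f a"
    using free_group_universal[OF f] by blast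
  then interpret h: group_hom "free_group S" G h by unfold_locales
  show thesis
    using h.FactGroup_universal_kernel[OF F.normal_n2p_verbal h.n2p_verbal_subset_kernel[OF laws]]
      that h(2) by (metis free_gen_closed n2p_free_def n2p_gen_def)
qed

section \<open>Homomorphisms from presented groups\<close>

definition presented_gen ::
  "nat \<Rightarrow> 'a set \<Rightarrow> (('a \<times> bool) list set set \<times> ('a \<times> bool) list set set) set \<Rightarrow> 'a
    \<Rightarrow> ('a \<times> bool) list set set set" where
  "presented_gen p S R a =
    normal_closure (n2p_free p S)
      {u \<otimes>\<^bsub>n2p_free p S\<^esub> inv\<^bsub>n2p_free p S\<^esub> v | u v. (u, v) \<in> R}
      #>\<^bsub>n2p_free p S\<^esub> n2p_gen p S a"

context
  fixes p :: nat and S :: "'a set"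
    and R :: "(('a \<times> bool) list set set \<times> ('a \<times> bool) list set set) set"
  assumes R: "R \<subseteq> carrier (n2p_free p S) \<times> carrier (n2p_free p S)"
begin

lemma relators_closed:
  "{u \<otimes>\<^bsub>n2p_free p S\<^esub> inv\<^bsub>n2p_free p S\<^esub> v | u v. (u, v) \<in> R} \<subseteq> carrier (n2p_free p S)"
proof -
  interpret group "n2p_free p S" by (rule group_n2p_free)
  show ?thesis using R by auto
qed

lemma group_n2p_presented: "group (n2p_presented p S R)"
  unfolding n2p_presented_def
  by (rule normal.factorgroup_is_group[OF
        group.normal_normal_closure[OF group_n2p_free relators_closed]])

lemma presented_gen_closed:
  "a \<in> S \<Longrightarrow> presented_gen p S R a \<in> carrier (n2p_presented p S R)"
  by (auto simp: presented_gen_def n2p_presented_def carrier_FactGroup n2p_gen_closed)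

text \<open>The kernel of \<open>h\<close> is normal and contains every relator, so it is one of the
  subgroups intersected in the normal closure, and \<open>h\<close> factors through the
  quotient.\<close>

lemma n2p_presented_universal:
  fixes G (structure)
  assumes G: "group G" "satisfies_n2p_laws p G" and h: "h \<in> hom (n2p_free p S) G"
    and rel: "\<And>u v. (u, v) \<in> R \<Longrightarrow> h u = h v"
  obtains g where "g \<in> hom (n2p_presented p S R) G"
    "\<And>a. a \<in> S \<Longrightarrow> g (presented_gen p S R a) = h (n2p_gen p S a)"
proof -
  interpret F: group "n2p_free p S" by (rule group_n2p_free)
  interpret h: group_hom "n2p_free p S" G h
    using G(1) h by (simp add: group_hom_def group_hom_axioms_def F.is_group)
  let ?rels = "{u \<otimes>\<^bsub>n2p_free p S\<^esub> inv\<^bsub>n2p_free p S\<^esub> v | u v. (u, v) \<in> R}"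
  have "?rels \<subseteq> kernel (n2p_free p S) G h"
    using R rel by (auto simp: kernel_def)
  then have "normal_closure (n2p_free p S) ?rels \<subseteq> kernel (n2p_free p S) G h"
    unfolding normal_closure_def by (intro Inter_lower) (simp add: h.normal_kernel)
  from h.FactGroup_universal_kernel[OF F.normal_normal_closure[OF relators_closed] this]
  obtain g where "g \<in> hom (n2p_presented p S R) G"
    and "\<And>u. u \<in> carrier (n2p_free p S) \<Longrightarrow>
      g (normal_closure (n2p_free p S) ?rels #>\<^bsub>n2p_free p S\<^esub> u) = h u"
    unfolding n2p_presented_def by blast
  then show thesis
    by (intro that[of g]) (simp_all add: presented_gen_def n2p_gen_closed)
qed

end

section \<open>A Heisenberg group of infinite rank\<close>

text \<open>
  The central coordinate is twisted by the evaluation pairing of functionals and vectors,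
  so that bilinearity of the cocycle is additivity of the functionals.
\<close>

definition heis :: "('v::ab_group_add \<times> ('v \<Rightarrow> int) \<times> int) monoid" where
  "heis = \<lparr>carrier = {(w, f, s). additive f},
     monoid.mult = (\<lambda>(w, f, s) (v, g, t). (w + v, f + g, s + t + f v)),
     monoid.one = (0, 0, 0)\<rparr>"

lemma heis_carrier [simp]: "(w, f, s) \<in> carrier heis \<longleftrightarrow> additive f"
  and heis_mult [simp]:
    "(w, f, s) \<otimes>\<^bsub>heis\<^esub> (v, g, t) = (w + v, f + g, s + t + f v)"
  and heis_one [simp]: "\<one>\<^bsub>heis\<^esub> = (0, 0, 0)"
  by (simp_all add: heis_def)

lemma additive_plus: "additive f \<Longrightarrow> additive g \<Longrightarrow> additive (f + g)"
  and additive_uminus: "additive f \<Longrightarrow> additive (- f)"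
  and additive_0: "additive 0"
  by (simp_all add: additive_def)

lemma heis_left_inverse:
  "additive f \<Longrightarrow> (- w, - f, - s + f w) \<otimes>\<^bsub>heis\<^esub> (w, f, s) = \<one>\<^bsub>heis\<^esub>"
  by simp

lemma group_heis: "group (heis :: ('v::ab_group_add \<times> ('v \<Rightarrow> int) \<times> int) monoid)"
proof (rule groupI)
  fix x :: "'v \<times> ('v \<Rightarrow> int) \<times> int" assume x: "x \<in> carrier heis"
  obtain w f s where "x = (w, f, s)" by (cases x)
  with x show "\<exists>y\<in>carrier heis. y \<otimes>\<^bsub>heis\<^esub> x = \<one>\<^bsub>heis\<^esub>"
    by (intro bexI[of _ "(- w, - f, - s + f w)"]) (simp_all add: additive_uminus)
qed (auto simp: additive_plus additive_0 additive.add algebra_simps)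

interpretation heis: group heis
  by (rule group_heis)

lemma heis_inv [simp]: "additive f \<Longrightarrow> inv\<^bsub>heis\<^esub> (w, f, s) = (- w, - f, - s + f w)"
  by (rule heis.inv_equality[OF heis_left_inverse]) (auto simp: additive_uminus)

text \<open>Only the antisymmetrization of the cocycle \<open>f v\<close> survives. Hence
  commutators are central and bilinear in the vector and functional coordinates.\<close>

lemma heis_commutator:
  assumes "additive f" "additive g"
  shows "commutator heis (w, f, s) (v, g, t) = (0, 0, f v - g w)"
  using assms
  by (simp add: commutator_def additive.minus additive.add additive_plus additive_uminus)

text \<open>Multiplying the \<open>n\<close>-th power by one more factor adds \<open>n * f w\<close>
  to the central coordinate; summing these terms gives the binomial coefficient.\<close>

lemma heis_pow:
  assumes "additive f"
  shows "(w, f, s) [^]\<^bsub>heis\<^esub> n =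
    (\<Sum>i<n. w, \<lambda>v. int n * f v, int n * s + int (n choose 2) * f w)"
  by (induction n) (auto simp: numeral_2_eq_2 algebra_simps fun_eq_iff zero_fun_def)

text \<open>
  The divisibility of the vector is tested by functionals, so that conjugation preserves this
  subgroup.
\<close>

definition heis_mod :: "nat \<Rightarrow> ('v::ab_group_add \<times> ('v \<Rightarrow> int) \<times> int) set" where
  "heis_mod p = {(w, f, s). additive f \<and> (\<forall>g. additive g \<longrightarrow> int p dvd g w)
    \<and> (\<forall>v. int p dvd f v) \<and> int p dvd s}"

lemma heis_mod_iff [simp]: "(w, f, s) \<in> heis_mod p \<longleftrightarrow>
    additive f \<and> (\<forall>g. additive g \<longrightarrow> int p dvd g w) \<and> (\<forall>v. int p dvd f v) \<and> int p dvd s"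
  by (simp add: heis_mod_def)

text \<open>Conjugating \<open>(w, f, s)\<close> by \<open>(v, g, t)\<close> only adds
  \<open>g w - f v\<close> to the central coordinate, and both terms are multiples of
  \<open>p\<close> by the definition of \<open>heis_mod\<close>.\<close>

lemma normal_heis_mod:
  "heis_mod p \<lhd> (heis :: ('v::ab_group_add \<times> ('v \<Rightarrow> int) \<times> int) monoid)"
proof (rule heis.normal_invI)
  show "subgroup (heis_mod p) heis"
  proof (rule heis.subgroupI)
    have "(0, 0, 0) \<in> heis_mod p"
      by (simp add: additive_0 additive.zero)
    then show "heis_mod p \<noteq> {}" by blast
  qed (auto simp: heis_mod_def additive_plus additive_uminus additive.add additive.minus)
  fix x h :: "'v \<times> ('v \<Rightarrow> int) \<times> int"
  assume "x \<in> carrier heis" "h \<in> heis_mod p"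
  then show "x \<otimes>\<^bsub>heis\<^esub> h \<otimes>\<^bsub>heis\<^esub> inv\<^bsub>heis\<^esub> x \<in> heis_mod p"
    by (cases x; cases h)
      (simp add: additive.minus additive_plus additive_uminus)
qed

text \<open>The class 2 law holds in \<open>heis\<close> itself. A \<open>p\<close>-th power lies in
  \<open>heis_mod p\<close> because an odd \<open>p\<close> divides
  \<open>p choose 2\<close>.\<close>

lemma heis_mod_laws:
  assumes "odd p"
  shows "satisfies_n2p_laws p (heis Mod heis_mod p :: ('v::ab_group_add \<times> ('v \<Rightarrow> int) \<times> int) set monoid)"
proof -
  interpret M: normal "heis_mod p" heis by (rule normal_heis_mod)
  interpret Q: group "heis Mod heis_mod p" by (rule M.factorgroup_is_group)
  interpret q: group_hom heis "heis Mod heis_mod p" "\<lambda>a. heis_mod p #>\<^bsub>heis\<^esub> a"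
    using M.r_coset_hom_Mod by unfold_locales
  note [simp del] = mult_FactGroup one_FactGroup heis_one
  have comm: "commutator heis (commutator heis x y) z = \<one>\<^bsub>heis\<^esub>"
    if "x \<in> carrier heis" "y \<in> carrier heis" "z \<in> carrier heis"
    for x y z :: "'v \<times> ('v \<Rightarrow> int) \<times> int"
    using that by (cases x; cases y; cases z)
      (simp add: heis_commutator additive_0 additive.zero heis_one)
  have pow: "x [^]\<^bsub>heis\<^esub> p \<in> heis_mod p" if x: "x \<in> carrier heis" for x :: "'v \<times> ('v \<Rightarrow> int) \<times> int"
  proof -
    obtain w f s where [simp]: "x = (w, f, s)" by (cases x)
    have f: "additive f" using x by simp
    obtain b where "p = 2 * b + 1" using assms by (rule oddE)
    then have "p choose 2 = p * b" by (simp add: choose_two)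
    moreover have "additive (\<lambda>v. int p * f v)"
      using f by (simp add: additive_def algebra_simps)
    moreover have "int p dvd g (\<Sum>i<p. w)" if "additive g" for g
    proof -
      have "g (\<Sum>i<n. w) = int n * g w" for n :: nat
        by (induction n) (auto simp: additive.zero additive.add that algebra_simps)
      then show ?thesis by simp
    qed
    ultimately show ?thesis
      by (simp add: heis_pow f)
  qed
  have "heis_mod p #>\<^bsub>heis\<^esub> (x [^]\<^bsub>heis\<^esub> p) = \<one>\<^bsub>heis Mod heis_mod p\<^esub>"
    if "x \<in> carrier heis" for x :: "'v \<times> ('v \<Rightarrow> int) \<times> int"
    using heis.coset_join2[OF _ M.subgroup_axioms pow] that by (simp add: one_FactGroup)
  then show ?thesis
    by (auto simp: satisfies_n2p_laws_def carrier_FactGroup q.hom_commutator[symmetric] comm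
        q.hom_nat_pow[symmetric])
qed

text \<open>
  Chosen so that \<open>f\<^sub>i e\<^sub>k - f\<^sub>k e\<^sub>i = 1\<close> whenever \<open>i < k\<close>, where
  \<open>e\<^sub>k\<close> and \<open>f\<^sub>k\<close> are the vector and the functional of the \<open>k\<close>-th element.
\<close>

definition heis_gen :: "nat \<Rightarrow> (nat \<Rightarrow> int) \<times> ((nat \<Rightarrow> int) \<Rightarrow> int) \<times> int" where
  "heis_gen k = (\<lambda>i. of_bool (i < k), \<lambda>w. w k, 0)"

lemma additive_apply: "additive (\<lambda>w :: nat \<Rightarrow> int. w k)"
  by (simp add: additive_def)

lemma heis_gen_closed: "heis_gen k \<in> carrier heis"
  by (simp add: heis_gen_def additive_apply)

lemma heis_gen_commutator: "i < k \<Longrightarrow> commutator heis (heis_gen i) (heis_gen k) = (0, 0, 1)"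
  by (simp add: heis_gen_def heis_commutator additive_apply)

lemma heis_gen_quotients_not_commuting:
  fixes p :: nat
  assumes "p > 1" "i < j" "j < k"
  defines "x \<equiv> heis_gen i \<otimes>\<^bsub>heis\<^esub> inv\<^bsub>heis\<^esub> heis_gen j"
    and "y \<equiv> heis_gen i \<otimes>\<^bsub>heis\<^esub> inv\<^bsub>heis\<^esub> heis_gen k"
  shows "heis_mod p #>\<^bsub>heis\<^esub> (x \<otimes>\<^bsub>heis\<^esub> y) \<noteq> heis_mod p #>\<^bsub>heis\<^esub> (y \<otimes>\<^bsub>heis\<^esub> x)"
proof
  assume "heis_mod p #>\<^bsub>heis\<^esub> (x \<otimes>\<^bsub>heis\<^esub> y) = heis_mod p #>\<^bsub>heis\<^esub> (y \<otimes>\<^bsub>heis\<^esub> x)"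
  moreover have "x \<otimes>\<^bsub>heis\<^esub> y \<in> carrier heis"
    unfolding x_def y_def by (intro heis.m_closed heis.inv_closed heis_gen_closed)
  ultimately have "x \<otimes>\<^bsub>heis\<^esub> y \<in> heis_mod p #>\<^bsub>heis\<^esub> (y \<otimes>\<^bsub>heis\<^esub> x)"
    using heis.rcos_self[OF _ normal_imp_subgroup[OF normal_heis_mod]] by metis
  then obtain w f s where m: "(w, f, s) \<in> heis_mod p"
    and eq: "x \<otimes>\<^bsub>heis\<^esub> y = (w, f, s) \<otimes>\<^bsub>heis\<^esub> (y \<otimes>\<^bsub>heis\<^esub> x)"
    by (force simp: r_coset_def)
  \<comment> \<open>Here \<open>v\<close> is the vector of \<open>y x\<close>. Comparing central
    coordinates, \<open>s + f v\<close> is the commutator form of \<open>x\<close> and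
    \<open>y\<close>. The pairs \<open>(i,i)\<close>, \<open>(i,k)\<close>, \<open>(j,i)\<close>,
    \<open>(j,k)\<close> contribute \<open>0 - 1 + 1 + 1\<close> to it.\<close>
  obtain v where "s + f v = 1"
    using eq assms(2,3) by (fastforce simp: x_def y_def heis_gen_def additive_apply)
  moreover have "int p dvd s + f v" using m by simp
  ultimately have "int p dvd 1" by simp
  with \<open>p > 1\<close> show False by simp
qed

section \<open>Abelian subgroups of finite index\<close>

text \<open>Some value is taken infinitely often, so indices with that value occur beyond any bound.
  Three indices are wanted because they yield two quotients to compare.\<close>

lemma obtain_increasing_triple_same_image:
  fixes c :: "nat \<Rightarrow> 'a"
  assumes "finite (range c)"
  obtains i j k where "i < j" "j < k" "c i = c j" "c i = c k"
proof -
  obtain i where "infinite {m. c m = c i}"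
    using pigeonhole_infinite[of "UNIV :: nat set" c] assms by auto
  then have next_index: "\<exists>l>n. c l = c i" for n
    by (simp add: infinite_nat_iff_unbounded)
  obtain j where "i < j" "c j = c i" using next_index by blast
  moreover obtain k where "j < k" "c k = c i" using next_index by blast
  ultimately show thesis using that by simp
qed

text \<open>Isolates what is needed of \<open>E\<close> and \<open>H\<close>. The homomorphism may
  have a kernel: elements commuting in \<open>G\<close> have commuting images, so a failure to
  commute in the quotient of \<open>heis\<close> suffices.\<close>

lemma no_abelian_finite_index_subgroup_if_hom_to_heis:
  fixes p :: nat and G (structure)
  assumes "group G" "p > 1" and h: "h \<in> hom G (heis Mod heis_mod p)"
    and x: "\<And>i. x i \<in> carrier G" "\<And>i. h (x i) = heis_mod p #>\<^bsub>heis\<^esub> heis_gen i"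
  shows "\<not> has_abelian_finite_index_subgroup G"
proof
  interpret group G by fact
  interpret M: normal "heis_mod p" heis by (rule normal_heis_mod)
  interpret Q: group "heis Mod heis_mod p" by (rule M.factorgroup_is_group)
  interpret q: group_hom heis "heis Mod heis_mod p" "\<lambda>a. heis_mod p #>\<^bsub>heis\<^esub> a"
    using M.r_coset_hom_Mod by unfold_locales
  interpret h: group_hom G "heis Mod heis_mod p" h
    using h by unfold_locales
  note [simp del] = mult_FactGroup one_FactGroup heis_one
  assume "has_abelian_finite_index_subgroup G"
  then obtain A where A: "subgroup A G" "comm_group (G\<lparr>carrier := A\<rparr>)" "finite (rcosets A)"
    by (auto simp: has_abelian_finite_index_subgroup_def)
  have "range (\<lambda>i. A #> x i) \<subseteq> rcosets A"
    using x subgroup.subset[OF A(1)] by (auto intro: rcosetsI)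
  then have "finite (range (\<lambda>i. A #> x i))"
    using A(3) finite_subset by blast
  then obtain i j k where ijk: "i < j" "j < k" "A #> x i = A #> x j" "A #> x i = A #> x k"
    by (rule obtain_increasing_triple_same_image)
  have mem: "x i \<otimes> inv x l \<in> A" if "A #> x i = A #> x l" for l
    using that x subgroup.subset[OF A(1)] A(1) coset_mult_inv2 coset_join1 by (metis m_closed inv_closed)
  define a b where "a = x i \<otimes> inv x j" and "b = x i \<otimes> inv x k"
  have "a \<otimes> b = b \<otimes> a"
    using comm_groupE(4)[OF A(2)] mem ijk by (simp add: a_def b_def)
  then have "h (a \<otimes> b) = h (b \<otimes> a)" by simp
  moreover have "h (x i \<otimes> inv x l) = heis_mod p #>\<^bsub>heis\<^esub> (heis_gen i \<otimes>\<^bsub>heis\<^esub> inv\<^bsub>heis\<^esub> heis_gen l)" for l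
    by (simp add: x heis_gen_closed)
  ultimately show False
    using heis_gen_quotients_not_commuting[OF \<open>p > 1\<close> ijk(1,2)] x
    by (simp add: a_def b_def heis_gen_closed flip: q.hom_mult)
qed

text \<open>Treats \<open>E\<close> and \<open>H\<close> together through the family
  \<open>Z\<close>, which may be constant. \<open>Z k\<close> is constrained only when some
  \<open>i < k\<close> exists, that is for \<open>k\<close> at least 1, so a missing
  \<open>Z 0\<close> is allowed.\<close>

lemma presented_no_abelian_finite_index_subgroup:
  fixes S :: "'a set" and X :: "nat \<Rightarrow> 'a" and p :: nat
  assumes p: "Factorial_Ring.prime p" "odd p"
    and S: "range X \<subseteq> S" "\<And>i k. i < k \<Longrightarrow> Z k \<in> S"
    and X: "inj X" "\<And>i k. i < k \<Longrightarrow> Z k \<notin> range X"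
  shows "\<not> has_abelian_finite_index_subgroup (n2p_presented p S
    {(commutator (n2p_free p S) (n2p_gen p S (X i)) (n2p_gen p S (X k)), n2p_gen p S (Z k)) | i k. i < (k::nat)})"
    (is "\<not> has_abelian_finite_index_subgroup (n2p_presented p S ?R)")
proof -
  interpret F: group "n2p_free p S" by (rule group_n2p_free)
  let ?K = "heis Mod heis_mod p :: ((nat \<Rightarrow> int) \<times> ((nat \<Rightarrow> int) \<Rightarrow> int) \<times> int) set monoid"
  interpret M: normal "heis_mod p" heis by (rule normal_heis_mod)
  interpret K: group ?K by (rule M.factorgroup_is_group)
  interpret q: group_hom heis ?K "\<lambda>a. heis_mod p #>\<^bsub>heis\<^esub> a"
    using M.r_coset_hom_Mod by unfold_locales
  have laws: "satisfies_n2p_laws p ?K" by (rule heis_mod_laws[OF p(2)])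
  \<comment> \<open>Every generator outside \<open>range X\<close>, in particular each
    \<open>Z k\<close> with \<open>k\<close> positive, goes to the class of
    \<open>(0, 0, 1)\<close>, the common commutator of the elements \<open>heis_gen i\<close> and
    \<open>heis_gen k\<close> for \<open>i < k\<close>.\<close>
  define f where "f a = heis_mod p #>\<^bsub>heis\<^esub>
    (if a \<in> range X then heis_gen (the_inv X a) else (0, 0, 1))" for a
  have "f \<in> S \<rightarrow> carrier ?K"
    unfolding f_def by (intro Pi_I q.hom_closed) (simp add: heis_gen_closed additive_0)
  then obtain h where h: "h \<in> hom (n2p_free p S) ?K" "\<And>a. a \<in> S \<Longrightarrow> h (n2p_gen p S a) = f a"
    using K.n2p_free_universal[OF laws] by metis
  interpret h: group_hom "n2p_free p S" ?K h using h(1) by unfold_locales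
  have fX: "f (X i) = heis_mod p #>\<^bsub>heis\<^esub> heis_gen i" for i
    using X(1) by (simp add: f_def the_inv_f_f)
  have XS: "X i \<in> S" for i using S(1) by blast
  have rel: "h u = h v" if "(u, v) \<in> ?R" for u v
  proof -
    obtain i k where ik: "i < k" "v = n2p_gen p S (Z k)"
      "u = commutator (n2p_free p S) (n2p_gen p S (X i)) (n2p_gen p S (X k))"
      using \<open>(u, v) \<in> ?R\<close> by blast
    have "h u = heis_mod p #>\<^bsub>heis\<^esub> commutator heis (heis_gen i) (heis_gen k)"
      by (simp add: ik h.hom_commutator n2p_gen_closed XS h(2) fX q.hom_commutator heis_gen_closed)
    then show ?thesis
      using ik S(2) X(2) by (simp add: heis_gen_commutator h(2) f_def)
  qed
  have R: "?R \<subseteq> carrier (n2p_free p S) \<times> carrier (n2p_free p S)"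
    using S by (auto simp: n2p_gen_closed XS)
  obtain g where g: "g \<in> hom (n2p_presented p S ?R) ?K"
    "\<And>a. a \<in> S \<Longrightarrow> g (presented_gen p S ?R a) = h (n2p_gen p S a)"
    by (rule n2p_presented_universal[OF R K.is_group laws h(1) rel]) (assumption | rule that)+
  show ?thesis
  proof (rule no_abelian_finite_index_subgroup_if_hom_to_heis
      [OF group_n2p_presented[OF R] prime_gt_1_nat[OF p(1)] g(1)])
    show "presented_gen p S ?R (X i) \<in> carrier (n2p_presented p S ?R)" for i
      by (rule presented_gen_closed[OF R XS])
    show "g (presented_gen p S ?R (X i)) = heis_mod p #>\<^bsub>heis\<^esub> heis_gen i" for i
      by (simp only: g(2) h(2) XS fX)
  qed
qed

theorem proposition4p1:
  fixes p :: nat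
  assumes "Factorial_Ring.prime p" and "odd p"
  shows "\<not> has_abelian_finite_index_subgroup (group_E p)
       \<and> \<not> has_abelian_finite_index_subgroup (group_H p)"
  unfolding group_E_def group_H_def Let_def
  using assms
  \<comment> \<open>Unification takes \<open>X = XE\<close> with the constant family
    \<open>ZE\<close> for \<open>E\<close>, and \<open>X = XH\<close>, \<open>Z = ZH\<close> for
    \<open>H\<close>.\<close>
  by (intro conjI presented_no_abelian_finite_index_subgroup) (auto simp: inj_def)

end
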